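(* Let $A$ be the vertex–arc incidence matrix of $G_d$, let $\succ$ be any term order, and let $\mathbf{c}=(c_{i,j})_{1\le i<j\le d}\in\mathbb{R}^n$ satisfy $c_{i,j}>c_{i,i+1}+c_{i+1,i+2}+\cdots+c_{j-1,j}$ for all $i<j-1$. Then the reduced Gröbner basis of $I_A$ with respect to $\succ_{\mathbf{c}}$ is $\{x_{i,j}-x_{i,i+1}x_{i+1,i+2}\cdots x_{j-1,j}: i<j-1\}$.
   Context: $G_d$ has vertices $1,\dots,d$ and arcs $(i,j)$, $1\le i<j\le d$, directed from $i$ to $j$; $n=\binom d2$. Its vertex–arc incidence matrix $A$ has in the column of arc $(i,j)$ entry $1$ in row $i$, $-1$ in row $j$, $0$ elsewhere. $I_A=\langle\mathbf{x}^{\mathbf{u}}-\mathbf{x}^{\mathbf{v}}:A\mathbf{u}=A\mathbf{v},\ \mathbf{u},\mathbf{v}\in\mathbb{N}^n\rangle\subseteq k[x_{i,j}]$. The refinement $\succ_{\mathbf{c}}$ orders monomials by $\mathbf{x}^{\mathbf{u}}\succ_{\mathbf{c}}\mathbf{x}^{\mathbf{v}}$ iff $\mathbf{c}\cdot\mathbf{u}>\mathbf{c}\cdot\mathbf{v}$, or equality and $\mathbf{x}^{\mathbf{u}}\succ\mathbf{x}^{\mathbf{v}}$. Since $I_A$ is homogeneous for the positive grading $\deg x_{i,j}=j-i$, $\succ_{\mathbf{c}}$ acts as a term order on $I_A$ and reduced Gröbner bases with respect to it exist. *)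

theory Defs
  imports Complex_Main "HOL-Library.Poly_Mapping"
begin

section \<open>Polynomials in a given set of variables\<close>

text \<open>
  A monomial is identified with its exponent vector, so the product of monomials is addition.
  The ring \<open>k[V]\<close> is the subring \<open>polys V\<close> of all polynomials over the type of variables.
\<close>

type_synonym 'x monomial = "'x \<Rightarrow>\<^sub>0 nat"
type_synonym ('x, 'k) mpoly = "('x \<Rightarrow>\<^sub>0 nat) \<Rightarrow>\<^sub>0 'k"

definition monomials :: "'x set \<Rightarrow> 'x monomial set" where
  "monomials V = {m. Poly_Mapping.keys m \<subseteq> V}"

definition polys :: "'x set \<Rightarrow> ('x, 'k::zero) mpoly set" where
  "polys V = {p. Poly_Mapping.keys p \<subseteq> monomials V}"

definition monom :: "'x monomial \<Rightarrow> ('x, 'k::comm_ring_1) mpoly" where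
  "monom m = Poly_Mapping.single m 1"

definition var :: "'x \<Rightarrow> ('x, 'k::comm_ring_1) mpoly" where
  "var x = monom (Poly_Mapping.single x 1)"

definition mon_dvd :: "'x monomial \<Rightarrow> 'x monomial \<Rightarrow> bool" where
  "mon_dvd m m' \<longleftrightarrow> (\<exists>r. m' = m + r)"

text \<open>The ideal of \<open>k[V]\<close> (not of the ambient ring) generated by \<open>F\<close>.\<close>

definition ideal_gen :: "'x set \<Rightarrow> ('x, 'k::comm_ring_1) mpoly set \<Rightarrow> ('x, 'k) mpoly set" where
  "ideal_gen V F = {\<Sum>f\<in>S. q f * f | S q. finite S \<and> S \<subseteq> F \<and> (\<forall>f\<in>S. q f \<in> polys V)}"


section \<open>Monomial orders and Groebner bases\<close>

text \<open>Orders are given by their strict relation: \<open>succ u v\<close> means that \<open>u\<close> is larger than \<open>v\<close>.\<close>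

definition term_order :: "'x set \<Rightarrow> ('x monomial \<Rightarrow> 'x monomial \<Rightarrow> bool) \<Rightarrow> bool" where
  "term_order V succ \<longleftrightarrow>
     (\<forall>u\<in>monomials V. \<not> succ u u) \<and>
     (\<forall>u\<in>monomials V. \<forall>v\<in>monomials V. \<forall>w\<in>monomials V. succ u v \<longrightarrow> succ v w \<longrightarrow> succ u w) \<and>
     (\<forall>u\<in>monomials V. \<forall>v\<in>monomials V. u \<noteq> v \<longrightarrow> succ u v \<or> succ v u) \<and>
     (\<forall>u\<in>monomials V. \<forall>v\<in>monomials V. \<forall>w\<in>monomials V. succ u v \<longrightarrow> succ (u + w) (v + w)) \<and>
     (\<forall>u\<in>monomials V. u \<noteq> 0 \<longrightarrow> succ u 0)"

definition weight :: "'x set \<Rightarrow> ('x \<Rightarrow> real) \<Rightarrow> 'x monomial \<Rightarrow> real" where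
  "weight V c u = (\<Sum>x\<in>V. c x * real (Poly_Mapping.lookup u x))"

definition refine_order ::
    "'x set \<Rightarrow> ('x \<Rightarrow> real) \<Rightarrow> ('x monomial \<Rightarrow> 'x monomial \<Rightarrow> bool) \<Rightarrow>
     'x monomial \<Rightarrow> 'x monomial \<Rightarrow> bool" where
  "refine_order V c succ u v \<longleftrightarrow>
     weight V c u > weight V c v \<or> (weight V c u = weight V c v \<and> succ u v)"

text \<open>
  The weights may be negative, in which case the refined order is a multiplicative total order
  but not a well-order. Initial monomials of nonzero polynomials exist nevertheless, and all
  notions below make sense for such orders.
\<close>

definition initial_mon ::
    "('x monomial \<Rightarrow> 'x monomial \<Rightarrow> bool) \<Rightarrow> ('x, 'k::zero) mpoly \<Rightarrow> 'x monomial" where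
  "initial_mon succ f = (THE m. m \<in> Poly_Mapping.keys f \<and> (\<forall>m'\<in>Poly_Mapping.keys f. m' \<noteq> m \<longrightarrow> succ m m'))"

definition initial_ideal ::
    "'x set \<Rightarrow> ('x monomial \<Rightarrow> 'x monomial \<Rightarrow> bool) \<Rightarrow> ('x, 'k::comm_ring_1) mpoly set \<Rightarrow>
     ('x, 'k) mpoly set" where
  "initial_ideal V succ I = ideal_gen V {monom (initial_mon succ f) | f. f \<in> I \<and> f \<noteq> 0}"

definition groebner_basis ::
    "'x set \<Rightarrow> ('x monomial \<Rightarrow> 'x monomial \<Rightarrow> bool) \<Rightarrow> ('x, 'k::comm_ring_1) mpoly set \<Rightarrow>
     ('x, 'k) mpoly set \<Rightarrow> bool" where
  "groebner_basis V succ I G \<longleftrightarrow>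
     finite G \<and> G \<subseteq> I \<and> 0 \<notin> G \<and>
     ideal_gen V {monom (initial_mon succ g) | g. g \<in> G} = initial_ideal V succ I"

text \<open>
  Reducedness: all elements are monic, and a monomial of an element \<open>g\<close> is divisible by the
  initial monomial of some \<open>h\<close> in \<open>G\<close> only if it is the initial monomial of \<open>g\<close> and \<open>h = g\<close>.
  For a term order the case of a noninitial monomial of \<open>g\<close> being divisible by the
  initial monomial of \<open>g\<close> itself cannot occur; for orders that are not well-orders it has to be
  excluded explicitly, since otherwise reduced bases would not be unique.
\<close>

definition reduced_groebner_basis ::
    "'x set \<Rightarrow> ('x monomial \<Rightarrow> 'x monomial \<Rightarrow> bool) \<Rightarrow> ('x, 'k::comm_ring_1) mpoly set \<Rightarrow>
     ('x, 'k) mpoly set \<Rightarrow> bool" where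
  "reduced_groebner_basis V succ I G \<longleftrightarrow>
     groebner_basis V succ I G \<and>
     (\<forall>g\<in>G. Poly_Mapping.lookup g (initial_mon succ g) = 1) \<and>
     (\<forall>g\<in>G. \<forall>h\<in>G. \<forall>m\<in>Poly_Mapping.keys g.
        mon_dvd (initial_mon succ h) m \<longrightarrow> h = g \<and> m = initial_mon succ g)"


section \<open>Toric ideals and the acyclic tournament graph\<close>

text \<open>A matrix with rows \<open>R\<close> and columns \<open>V\<close> is a function of a row and a column index.\<close>

definition mat_apply :: "'x set \<Rightarrow> ('r \<Rightarrow> 'x \<Rightarrow> int) \<Rightarrow> 'x monomial \<Rightarrow> 'r \<Rightarrow> int" where
  "mat_apply V A u r = (\<Sum>x\<in>V. A r x * int (Poly_Mapping.lookup u x))"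

definition toric_ideal ::
    "'r set \<Rightarrow> 'x set \<Rightarrow> ('r \<Rightarrow> 'x \<Rightarrow> int) \<Rightarrow> ('x, 'k::comm_ring_1) mpoly set" where
  "toric_ideal R V A =
     ideal_gen V {monom u - monom v | u v.
       u \<in> monomials V \<and> v \<in> monomials V \<and> (\<forall>r\<in>R. mat_apply V A u r = mat_apply V A v r)}"

definition arcs :: "nat \<Rightarrow> (nat \<times> nat) set" where
  "arcs d = {(i, j). 1 \<le> i \<and> i < j \<and> j \<le> d}"

definition incidence :: "nat \<Rightarrow> nat \<times> nat \<Rightarrow> int" where
  "incidence v a = (if v = fst a then 1 else if v = snd a then -1 else 0)"

definition tournament_ideal :: "nat \<Rightarrow> (nat \<times> nat, 'k::comm_ring_1) mpoly set" where
  "tournament_ideal d = toric_ideal {1..d} (arcs d) incidence"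

end

theory Submission
  imports Defs
begin

text \<open>
  Call a monomial a path monomial if it only involves the variables of arcs \<open>(l, l + 1)\<close>. Replacing
  every \<open>x_(i,j)\<close> by the product along the path from \<open>i\<close> to \<open>j\<close> maps a monomial to the unique path
  monomial in its fibre of \<open>A\<close>, and strictly decreases the \<open>c\<close>-weight unless the monomial was
  already a path monomial. The coefficients of an element of \<open>I_A\<close> add up to zero over each
  fibre of \<open>A\<close>, so a path monomial in its support is accompanied by another monomial of the same
  fibre, which is larger. Hence no initial monomial is a path monomial, i.e. the
  initial ideal is generated by the variables \<open>x_(i,j)\<close> with \<open>i < j - 1\<close>. For uniqueness, the
  difference of two candidates with the same initial variable lies in \<open>I_A\<close> and contains only
  path monomials, so it vanishes; thus no division algorithm (which need not terminate for
  \<open>c\<close> with negative entries) is required.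
\<close>

section \<open>Monomials and ideals\<close>

lemma monomials_add:
  "u \<in> monomials V \<Longrightarrow> v \<in> monomials V \<Longrightarrow> u + v \<in> monomials V"
  using keys_add[of u v] by (auto simp: monomials_def)

lemma polys_zero: "0 \<in> polys V"
  by (simp add: polys_def)

lemma polys_monom: "m \<in> monomials V \<Longrightarrow> monom m \<in> polys V"
  by (simp add: polys_def monom_def)

lemma polys_add: "p \<in> polys V \<Longrightarrow> q \<in> polys V \<Longrightarrow> p + q \<in> polys V"
  using keys_add[of p q] by (auto simp: polys_def)

lemma polys_diff:
  fixes p q :: "('x, 'k::comm_ring_1) mpoly"
  shows "p \<in> polys V \<Longrightarrow> q \<in> polys V \<Longrightarrow> p - q \<in> polys V"
  using keys_diff[of p q] by (auto simp: polys_def)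

lemma polys_mult:
  fixes p q :: "('x, 'k::comm_ring_1) mpoly"
  assumes "p \<in> polys V" "q \<in> polys V"
  shows "p * q \<in> polys V"
  using assms keys_mult[of p q] by (fastforce simp: polys_def intro: monomials_add)

lemma polys_sum: "(\<And>x. x \<in> S \<Longrightarrow> f x \<in> polys V) \<Longrightarrow> sum f S \<in> polys V"
  by (induction S rule: infinite_finite_induct) (auto intro: polys_zero polys_add)

lemma monom_add: "monom (u + v) = monom u * monom v"
  by (simp add: monom_def mult_single)

lemma monom_zero: "monom 0 = 1"
  by (simp add: monom_def)

lemma prod_monom: "(\<Prod>x\<in>S. monom (f x)) = monom (\<Sum>x\<in>S. f x)"
  by (induction S rule: infinite_finite_induct) (auto simp: monom_add monom_zero)

lemma ideal_genI:
  "finite S \<Longrightarrow> S \<subseteq> F \<Longrightarrow> \<forall>f\<in>S. q f \<in> polys V \<Longrightarrow> (\<Sum>f\<in>S. q f * f) \<in> ideal_gen V F"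
  unfolding ideal_gen_def by blast

lemma ideal_genE:
  assumes "p \<in> ideal_gen V F"
  obtains S q where "finite S" "S \<subseteq> F" "\<forall>f\<in>S. q f \<in> polys V" "p = (\<Sum>f\<in>S. q f * f)"
  using assms unfolding ideal_gen_def by blast

lemma ideal_gen_base:
  assumes "f \<in> F"
  shows "f \<in> ideal_gen V F"
  using ideal_genI[of "{f}" F "\<lambda>_. 1" V] assms polys_monom[of 0 V]
  by (simp add: monom_zero monomials_def)

lemma ideal_gen_zero: "0 \<in> ideal_gen V F"
  using ideal_genI[of "{}" F] by simp

lemma ideal_gen_add:
  assumes "p \<in> ideal_gen V F" "q \<in> ideal_gen V F"
  shows "p + q \<in> ideal_gen V F"
proof -
  obtain S a where S: "finite S" "S \<subseteq> F" "\<forall>f\<in>S. a f \<in> polys V" "p = (\<Sum>f\<in>S. a f * f)"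
    using assms(1) by (rule ideal_genE)
  obtain T b where T: "finite T" "T \<subseteq> F" "\<forall>f\<in>T. b f \<in> polys V" "q = (\<Sum>f\<in>T. b f * f)"
    using assms(2) by (rule ideal_genE)
  \<comment> \<open>Both coefficient families are extended by zero, so that the two combinations run
    over the common index set \<open>S \<union> T\<close>.\<close>
  define e where "e f = (if f \<in> S then a f else 0) + (if f \<in> T then b f else 0)" for f
  have "p = (\<Sum>f\<in>S \<union> T. (if f \<in> S then a f else 0) * f)"
    unfolding S(4) by (intro sum.mono_neutral_cong_left) (use S T in auto)
  moreover have "q = (\<Sum>f\<in>S \<union> T. (if f \<in> T then b f else 0) * f)"
    unfolding T(4) by (intro sum.mono_neutral_cong_left) (use S T in auto)
  ultimately have "p + q = (\<Sum>f\<in>S \<union> T. e f * f)"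
    by (simp add: e_def sum.distrib ring_distribs)
  moreover have "e f \<in> polys V" for f
    unfolding e_def by (intro polys_add) (use S T in \<open>auto intro: polys_zero\<close>)
  ultimately show ?thesis
    using S T by (auto intro: ideal_genI)
qed

lemma ideal_gen_mult:
  assumes "p \<in> ideal_gen V F" "r \<in> polys V"
  shows "r * p \<in> ideal_gen V F"
proof -
  obtain S q where S: "finite S" "S \<subseteq> F" "\<forall>f\<in>S. q f \<in> polys V" "p = (\<Sum>f\<in>S. q f * f)"
    using assms(1) by (rule ideal_genE)
  have "r * p = (\<Sum>f\<in>S. (r * q f) * f)"
    by (simp add: S(4) sum_distrib_left mult.assoc)
  then show ?thesis
    using S assms(2) by (auto intro!: ideal_genI polys_mult)
qed

lemma ideal_gen_diff:
  fixes p q :: "('x, 'k::comm_ring_1) mpoly"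
  assumes "p \<in> ideal_gen V F" "q \<in> ideal_gen V F"
  shows "p - q \<in> ideal_gen V F"
proof -
  have "(- 1 :: ('x, 'k) mpoly) \<in> polys V"
    using polys_diff[OF polys_zero polys_monom[of 0 V]] by (simp add: monom_zero monomials_def)
  then have "- 1 * q \<in> ideal_gen V F"
    using assms(2) by (intro ideal_gen_mult)
  then show ?thesis
    using ideal_gen_add[OF assms(1)] by fastforce
qed

lemma ideal_gen_subset:
  assumes "F \<subseteq> ideal_gen V F'"
  shows "ideal_gen V F \<subseteq> ideal_gen V F'"
proof
  fix p assume "p \<in> ideal_gen V F"
  then obtain S q where S: "S \<subseteq> F" "\<forall>f\<in>S. q f \<in> polys V" "p = (\<Sum>f\<in>S. q f * f)"
    by (rule ideal_genE)
  have "(\<Sum>f\<in>T. q f * f) \<in> ideal_gen V F'" if "T \<subseteq> S" for T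
    using that
    by (induction T rule: infinite_finite_induct)
      (use S(1,2) assms in \<open>auto intro!: ideal_gen_zero ideal_gen_add ideal_gen_mult\<close>)
  then show "p \<in> ideal_gen V F'"
    using S by blast
qed

lemma ideal_gen_subset_polys:
  assumes "F \<subseteq> polys V"
  shows "ideal_gen V F \<subseteq> polys V"
proof
  fix p assume "p \<in> ideal_gen V F"
  then show "p \<in> polys V"
    by (rule ideal_genE) (use assms in \<open>auto intro!: polys_sum polys_mult\<close>)
qed

text \<open>Cancellation cannot create monomials: \<open>m\<close> occurs in some summand
  \<open>q f * f\<close>, and with \<open>f = monom a\<close> every monomial of that summand is a
  multiple of \<open>a\<close>.\<close>

lemma mon_dvd_if_monom_in_ideal_gen:
  fixes M :: "'x monomial set"
  assumes "(monom m :: ('x, 'k::comm_ring_1) mpoly) \<in> ideal_gen V (monom ` M)"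
  obtains a where "a \<in> M" "mon_dvd a m"
proof -
  obtain S and q :: "('x, 'k) mpoly \<Rightarrow> ('x, 'k) mpoly"
    where S: "S \<subseteq> monom ` M" "monom m = (\<Sum>f\<in>S. q f * f)"
    using assms by (rule ideal_genE)
  have "m \<in> Poly_Mapping.keys (monom m :: ('x, 'k) mpoly)"
    by (simp add: monom_def)
  then obtain f where f: "f \<in> S" "m \<in> Poly_Mapping.keys (q f * f)"
    unfolding S(2) using keys_sum[of "\<lambda>f. q f * f" S] by blast
  then obtain a where a: "a \<in> M" "f = monom a"
    using S(1) by blast
  obtain b where "m = b + a"
    using f(2) keys_mult[of "q f" f] by (auto simp: a(2) monom_def)
  then have "mon_dvd a m"
    by (auto simp: mon_dvd_def intro!: exI[of _ b] add.commute)
  with a(1) show ?thesis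
    by (rule that)
qed

lemma monom_in_ideal_gen_if_mon_dvd:
  assumes "m \<in> monomials V" "a \<in> M" "mon_dvd a m"
  shows "monom m \<in> ideal_gen V (monom ` M)"
proof -
  obtain r where r: "m = a + r"
    using assms(3) by (auto simp: mon_dvd_def)
  \<comment> \<open>Cofactors have to come from \<open>polys V\<close>, so \<open>r\<close> must not
    involve a variable outside \<open>V\<close>.\<close>
  have "Poly_Mapping.keys r \<subseteq> Poly_Mapping.keys m"
    by (auto simp: r in_keys_iff lookup_add)
  then have "monom r \<in> polys V"
    using assms(1) by (intro polys_monom) (auto simp: monomials_def)
  then have "monom r * monom a \<in> ideal_gen V (monom ` M)"
    using assms(2) by (intro ideal_gen_mult ideal_gen_base) auto
  then show ?thesis
    by (simp add: r monom_add mult.commute)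
qed

section \<open>Initial monomials\<close>

lemma refine_order_irrefl:
  "term_order V succ \<Longrightarrow> u \<in> monomials V \<Longrightarrow> \<not> refine_order V c succ u u"
  by (auto simp: term_order_def refine_order_def)

lemma refine_order_trans:
  "\<lbrakk>term_order V succ; u \<in> monomials V; v \<in> monomials V; w \<in> monomials V;
    refine_order V c succ u v; refine_order V c succ v w\<rbrakk> \<Longrightarrow> refine_order V c succ u w"
  unfolding term_order_def refine_order_def by (smt (verit))

lemma refine_order_total:
  "\<lbrakk>term_order V succ; u \<in> monomials V; v \<in> monomials V; u \<noteq> v\<rbrakk> \<Longrightarrow>
    refine_order V c succ u v \<or> refine_order V c succ v u"
  unfolding term_order_def refine_order_def by (smt (verit))

text \<open>Makes the definite description usable: two distinct maxima of the support would dominate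
  each other, against transitivity and irreflexivity.\<close>

lemma initial_mon_eqI:
  assumes "term_order V succ" "f \<in> polys V" "m \<in> Poly_Mapping.keys f"
    and max: "\<And>m'. m' \<in> Poly_Mapping.keys f \<Longrightarrow> m' \<noteq> m \<Longrightarrow> refine_order V c succ m m'"
  shows "initial_mon (refine_order V c succ) f = m"
  unfolding initial_mon_def
proof (rule the_equality)
  fix m' assume m': "m' \<in> Poly_Mapping.keys f \<and> (\<forall>m''\<in>Poly_Mapping.keys f. m'' \<noteq> m' \<longrightarrow> refine_order V c succ m' m'')"
  show "m' = m"
  proof (rule ccontr)
    assume "m' \<noteq> m"
    then have "refine_order V c succ m m'" "refine_order V c succ m' m"
      using m' assms(3) max by auto
    then show False
      using assms(1-3) m' refine_order_trans[of V succ m m' m c] refine_order_irrefl[of V succ m c]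
      by (auto simp: polys_def)
  qed
qed (use assms in auto)

text \<open>Only finiteness of the support and totality of the order enter, so the refined order may
  fail to be well-founded.\<close>

lemma initial_mon_props:
  fixes c :: "'x \<Rightarrow> real"
  assumes ord: "term_order V succ" and f: "f \<in> polys V" "f \<noteq> 0"
  defines "m \<equiv> initial_mon (refine_order V c succ) f"
  shows "m \<in> Poly_Mapping.keys f" "\<And>m'. m' \<in> Poly_Mapping.keys f \<Longrightarrow> m' \<noteq> m \<Longrightarrow> refine_order V c succ m m'"
proof -
  have V: "u \<in> monomials V" if "u \<in> Poly_Mapping.keys f" for u
    using f(1) that by (auto simp: polys_def)
  \<comment> \<open>The largest monomial is a least element when the strict relation is read in the
    reverse direction.\<close>
  have "\<exists>l\<in>Poly_Mapping.keys f. \<forall>x\<in>Poly_Mapping.keys f. x \<noteq> l \<longrightarrow> refine_order V c succ l x"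
  proof (rule Finite_Set.bex_least_element)
    show "transp_on (Poly_Mapping.keys f) (refine_order V c succ)"
      by (rule transp_onI) (rule refine_order_trans[OF ord]; auto intro: V)
    show "totalp_on (Poly_Mapping.keys f) (refine_order V c succ)"
      by (rule totalp_onI) (rule refine_order_total[OF ord]; auto intro: V)
  qed (use f(2) in auto)
  then obtain l where l: "l \<in> Poly_Mapping.keys f" "\<And>x. x \<in> Poly_Mapping.keys f \<Longrightarrow> x \<noteq> l \<Longrightarrow> refine_order V c succ l x"
    by blast
  then have "m = l"
    unfolding m_def using ord f(1) by (intro initial_mon_eqI) auto
  with l show "m \<in> Poly_Mapping.keys f" "\<And>m'. m' \<in> Poly_Mapping.keys f \<Longrightarrow> m' \<noteq> m \<Longrightarrow> refine_order V c succ m m'"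
    by auto
qed

section \<open>Toric ideals\<close>

text \<open>\<open>P\<close> is meant to be membership in a fibre of the matrix. Filtering by
  \<open>if\<close> rather than by the index set makes it easy to enlarge the support, which gives
  additivity.\<close>

definition fibre_sum :: "('x monomial \<Rightarrow> bool) \<Rightarrow> ('x, 'k::comm_ring_1) mpoly \<Rightarrow> 'k" where
  "fibre_sum P p = (\<Sum>m\<in>Poly_Mapping.keys p. if P m then Poly_Mapping.lookup p m else 0)"

lemma fibre_sum_superset:
  assumes "finite K" "Poly_Mapping.keys p \<subseteq> K"
  shows "fibre_sum P p = (\<Sum>m\<in>K. if P m then Poly_Mapping.lookup p m else 0)"
  unfolding fibre_sum_def using assms by (intro sum.mono_neutral_left) (auto simp: in_keys_iff)

lemma fibre_sum_add: "fibre_sum P (p + q) = fibre_sum P p + fibre_sum P q"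
proof -
  let ?K = "Poly_Mapping.keys p \<union> Poly_Mapping.keys q"
  have "fibre_sum P r = (\<Sum>m\<in>?K. if P m then Poly_Mapping.lookup r m else 0)"
    if "r \<in> {p, q, p + q}" for r
    using that keys_add[of p q] by (intro fibre_sum_superset) auto
  then show ?thesis
    by (auto simp: lookup_add simp flip: sum.distrib intro!: sum.cong)
qed

lemma fibre_sum_zero: "fibre_sum P 0 = 0"
  by (simp add: fibre_sum_def)

lemma fibre_sum_sum: "fibre_sum P (sum f S) = (\<Sum>x\<in>S. fibre_sum P (f x))"
  by (induction S rule: infinite_finite_induct) (auto simp: fibre_sum_add fibre_sum_zero)

lemma fibre_sum_single: "fibre_sum P (Poly_Mapping.single m a) = (if P m then a else 0)"
  by (simp add: fibre_sum_def)

lemma mpoly_eq_sum_single: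
  fixes p :: "('x, 'k::comm_ring_1) mpoly"
  shows "p = (\<Sum>m\<in>Poly_Mapping.keys p. Poly_Mapping.single m (Poly_Mapping.lookup p m))"
  by (rule poly_mapping_eqI) (auto simp: lookup_sum lookup_single when_def in_keys_iff)

lemma mat_apply_add: "mat_apply V A (u + v) r = mat_apply V A u r + mat_apply V A v r"
  by (simp add: mat_apply_def lookup_add ring_distribs sum.distrib)

lemma mat_apply_zero: "mat_apply V A 0 r = 0"
  by (simp add: mat_apply_def)

lemma mat_apply_sum: "mat_apply V A (sum f S) r = (\<Sum>x\<in>S. mat_apply V A (f x) r)"
  by (induction S rule: infinite_finite_induct) (auto simp: mat_apply_add mat_apply_zero)

lemma mat_apply_single:
  assumes "finite V" "x \<in> V"
  shows "mat_apply V A (Poly_Mapping.single x n) r = A r x * int n"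
proof -
  have "mat_apply V A (Poly_Mapping.single x n) r = (\<Sum>y\<in>V. if y = x then A r x * int n else 0)"
    unfolding mat_apply_def by (intro sum.cong) (auto simp: lookup_single when_def)
  then show ?thesis
    using assms by simp
qed

lemma toric_ideal_subset_polys: "toric_ideal R V A \<subseteq> polys V"
  unfolding toric_ideal_def by (intro ideal_gen_subset_polys) (auto intro: polys_diff polys_monom)

lemma toric_ideal_binomialI:
  assumes "u \<in> monomials V" "v \<in> monomials V"
    and "\<And>r. r \<in> R \<Longrightarrow> mat_apply V A u r = mat_apply V A v r"
  shows "monom u - monom v \<in> toric_ideal R V A"
  unfolding toric_ideal_def by (rule ideal_gen_base) (use assms in blast)

text \<open>By linearity \<open>q\<close> may be taken to be a single term. The product then has two
  terms with opposite coefficients whose monomials both satisfy \<open>P\<close> or both fail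
  it.\<close>

lemma fibre_sum_mult_binomial:
  fixes q :: "('x, 'k::comm_ring_1) mpoly"
  assumes "\<And>m. P (m + u) \<longleftrightarrow> P (m + v)"
  shows "fibre_sum P (q * (monom u - monom v)) = 0"
proof -
  have "fibre_sum P (Poly_Mapping.single m a * (monom u - monom v :: ('x, 'k) mpoly)) = 0" for m a
  proof -
    have "Poly_Mapping.single m a * (monom u - monom v :: ('x, 'k) mpoly) =
      Poly_Mapping.single (m + u) a + Poly_Mapping.single (m + v) (- a)"
      by (simp add: monom_def right_diff_distrib mult_single single_uminus)
    then show ?thesis
      using assms by (simp add: fibre_sum_add fibre_sum_single)
  qed
  then show ?thesis
    by (subst mpoly_eq_sum_single[of q]) (simp add: sum_distrib_right fibre_sum_sum)
qed

text \<open>The sum of the coefficients over the fibre of \<open>m\<close> vanishes on the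
  generators and their multiples. If \<open>m\<close> were alone in its fibre, this sum would be its
  nonzero coefficient.\<close>

lemma toric_ideal_other_monomial_in_fibre:
  fixes f :: "('x, 'k::comm_ring_1) mpoly"
  assumes f: "f \<in> toric_ideal R V A" and m: "m \<in> Poly_Mapping.keys f"
  obtains m' where "m' \<in> Poly_Mapping.keys f" "m' \<noteq> m" "\<And>r. r \<in> R \<Longrightarrow> mat_apply V A m' r = mat_apply V A m r"
proof -
  define P where "P u \<longleftrightarrow> (\<forall>r\<in>R. mat_apply V A u r = mat_apply V A m r)" for u
  have zero: "fibre_sum P f = 0"
    using f unfolding toric_ideal_def
  proof (rule ideal_genE)
    fix S and q :: "('x, 'k) mpoly \<Rightarrow> ('x, 'k) mpoly"
    assume S: "S \<subseteq> {monom u - monom v | u v. u \<in> monomials V \<and> v \<in> monomials V \<and>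
        (\<forall>r\<in>R. mat_apply V A u r = mat_apply V A v r)}"
      and f: "f = (\<Sum>g\<in>S. q g * g)"
    have "fibre_sum P (q g * g) = 0" if g: "g \<in> S" for g
    proof -
      obtain u v where uv: "g = monom u - monom v" "\<forall>r\<in>R. mat_apply V A u r = mat_apply V A v r"
        using S g by blast
      \<comment> \<open>Linearity of the matrix: shifting both monomials of a generator by
        \<open>n\<close> keeps them in a common fibre.\<close>
      then have "P (n + u) \<longleftrightarrow> P (n + v)" for n
        by (simp add: P_def mat_apply_add)
      then show ?thesis
        unfolding uv(1) by (rule fibre_sum_mult_binomial)
    qed
    then show ?thesis
      by (simp add: f fibre_sum_sum)
  qed
  have "\<exists>m'\<in>Poly_Mapping.keys f. m' \<noteq> m \<and> P m'"
  proof (rule ccontr)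
    assume "\<not> ?thesis"
    then have "fibre_sum P f = (\<Sum>m'\<in>Poly_Mapping.keys f. if m' = m then Poly_Mapping.lookup f m else 0)"
      unfolding fibre_sum_def by (intro sum.cong) (auto simp: P_def)
    then show False
      using zero m by (simp add: in_keys_iff)
  qed
  then show ?thesis
    using that by (auto simp: P_def)
qed

section \<open>The tournament graph\<close>

lemma finite_arcs: "finite (arcs d)"
  by (rule finite_subset[of _ "{..d} \<times> {..d}"]) (auto simp: arcs_def)

definition path_mon :: "nat \<Rightarrow> nat \<Rightarrow> (nat \<times> nat) monomial" where
  "path_mon i j = (\<Sum>l = i..<j. Poly_Mapping.single (l, Suc l) 1)"

lemma lookup_path_mon:
  "Poly_Mapping.lookup (path_mon i j) (a, b) = (if b = Suc a \<and> i \<le> a \<and> a < j then 1 else 0)"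
proof -
  have "Poly_Mapping.lookup (path_mon i j) (a, b) =
      (\<Sum>l = i..<j. if l = a then (if b = Suc a then 1 else 0) else 0)"
    unfolding path_mon_def lookup_sum by (intro sum.cong) (auto simp: lookup_single when_def)
  then show ?thesis
    by simp
qed

lemma keys_path_mon: "Poly_Mapping.keys (path_mon i j) = (\<lambda>l. (l, Suc l)) ` {i..<j}"
  by (auto simp: in_keys_iff lookup_path_mon split: if_splits)

lemma path_mon_in_monomials: "1 \<le> i \<Longrightarrow> j \<le> d \<Longrightarrow> path_mon i j \<in> monomials (arcs d)"
  by (auto simp: monomials_def keys_path_mon arcs_def)

lemma single_in_monomials: "x \<in> V \<Longrightarrow> Poly_Mapping.single x n \<in> monomials V"
  by (auto simp: monomials_def split: if_splits)

lemma mat_apply_path_mon: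
  assumes "(i, j) \<in> arcs d"
  shows "mat_apply (arcs d) incidence (path_mon i j) r =
    mat_apply (arcs d) incidence (Poly_Mapping.single (i, j) 1) r"
proof -
  have "i < j"
    using assms by (simp add: arcs_def)
  \<comment> \<open>\<open>g l\<close> is the entry in row \<open>r\<close> of the unit vector at
    \<open>l\<close>. The column of an arc is a difference of two unit vectors, so the columns along
    a path telescope.\<close>
  define g :: "nat \<Rightarrow> int" where "g l = (if l = r then 1 else 0)" for l
  have inc: "incidence r (a, b) = g a - g b" if "a < b" for a b
    using that by (auto simp: incidence_def g_def)
  have "mat_apply (arcs d) incidence (path_mon i j) r = (\<Sum>l = i..<j. g l - g (Suc l))"
    unfolding path_mon_def mat_apply_sum
  proof (intro sum.cong refl)
    fix l assume "l \<in> {i..<j}"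
    then have "(l, Suc l) \<in> arcs d"
      using assms by (auto simp: arcs_def)
    then show "mat_apply (arcs d) incidence (Poly_Mapping.single (l, Suc l) 1) r = g l - g (Suc l)"
      by (simp add: mat_apply_single finite_arcs inc)
  qed
  also have "\<dots> = g i - g j"
    using \<open>i < j\<close> sum_Suc_diff'[of i j g] by (simp add: sum_subtractf)
  also have "\<dots> = mat_apply (arcs d) incidence (Poly_Mapping.single (i, j) 1) r"
    using assms \<open>i < j\<close> by (simp add: mat_apply_single finite_arcs inc)
  finally show ?thesis .
qed

section \<open>Cuts and path monomials\<close>

definition cut :: "nat \<Rightarrow> nat \<Rightarrow> (nat \<times> nat) monomial \<Rightarrow> nat" where
  "cut d l u = (\<Sum>(i, j)\<in>{(i, j) \<in> arcs d. i \<le> l \<and> l < j}. Poly_Mapping.lookup u (i, j))"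

lemma cut_alt:
  "cut d l u = (\<Sum>a\<in>arcs d. if fst a \<le> l \<and> l < snd a then Poly_Mapping.lookup u a else 0)"
proof -
  have "{(i, j) \<in> arcs d. i \<le> l \<and> l < j} = {a \<in> arcs d. fst a \<le> l \<and> l < snd a}"
    by auto
  then show ?thesis
    by (simp add: cut_def case_prod_unfold sum.inter_filter[symmetric] finite_arcs del: One_nat_def)
qed

text \<open>Add the rows \<open>1..l\<close>: an arc with both ends among them contributes
  \<open>1 - 1\<close>, an arc leaving them contributes 1, and no arc enters them because arcs
  increase. Hence the cuts are constant on fibres.\<close>

lemma cut_eq_sum_mat_apply:
  assumes "l < d"
  shows "int (cut d l u) = (\<Sum>r = 1..l. mat_apply (arcs d) incidence u r)"
proof -
  have inc: "(\<Sum>r = 1..l. incidence r a) = (if fst a \<le> l \<and> l < snd a then 1 else 0)"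
    if "a \<in> arcs d" for a
  proof -
    have "(\<Sum>r = 1..l. incidence r a) =
      (\<Sum>r = 1..l. if r = fst a then 1 else 0) - (\<Sum>r = 1..l. if r = snd a then 1 else 0)"
      unfolding sum_subtractf[symmetric]
      using that by (intro sum.cong) (auto simp: incidence_def arcs_def)
    then show ?thesis
      using that by (auto simp: arcs_def)
  qed
  have "(\<Sum>r = 1..l. mat_apply (arcs d) incidence u r) =
      (\<Sum>a\<in>arcs d. (\<Sum>r = 1..l. incidence r a) * int (Poly_Mapping.lookup u a))"
    unfolding mat_apply_def sum_distrib_right by (rule sum.swap)
  also have "\<dots> = (\<Sum>a\<in>arcs d. if fst a \<le> l \<and> l < snd a then int (Poly_Mapping.lookup u a) else 0)"
    by (intro sum.cong refl) (simp add: inc del: One_nat_def)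
  also have "\<dots> = int (cut d l u)"
    unfolding cut_alt of_nat_sum by (intro sum.cong refl) auto
  finally show ?thesis ..
qed

lemma cut_cong:
  assumes "l < d"
    and "\<And>r. r \<in> {1..d} \<Longrightarrow> mat_apply (arcs d) incidence u r = mat_apply (arcs d) incidence v r"
  shows "cut d l u = cut d l v"
proof -
  have "int (cut d l u) = int (cut d l v)"
    unfolding cut_eq_sum_mat_apply[OF assms(1)] using assms by (intro sum.cong) auto
  then show ?thesis
    by simp
qed

text \<open>These turn out to be the standard monomials, those outside the initial ideal.\<close>

definition path_monomials :: "nat \<Rightarrow> (nat \<times> nat) monomial set" where
  "path_monomials d = monomials {(i, j) \<in> arcs d. j = Suc i}"

lemma path_monomials_subset: "path_monomials d \<subseteq> monomials (arcs d)"
  by (auto simp: path_monomials_def monomials_def)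

lemma not_path_monomial_iff_dvd:
  assumes "m \<in> monomials (arcs d)"
  shows "m \<notin> path_monomials d \<longleftrightarrow>
    (\<exists>i j. 1 \<le> i \<and> Suc i < j \<and> j \<le> d \<and> mon_dvd (Poly_Mapping.single (i, j) 1) m)"
proof -
  have dvd: "mon_dvd (Poly_Mapping.single x 1) m \<longleftrightarrow> x \<in> Poly_Mapping.keys m" for x
  proof
    assume "x \<in> Poly_Mapping.keys m"
    \<comment> \<open>The subtraction is truncated, but exact here since the exponent of
      \<open>x\<close> in \<open>m\<close> is at least 1.\<close>
    then have "m = Poly_Mapping.single x 1 + (m - Poly_Mapping.single x 1)"
      by (intro poly_mapping_eqI) (auto simp: lookup_add lookup_minus lookup_single when_def in_keys_iff)
    then show "mon_dvd (Poly_Mapping.single x 1) m"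
      unfolding mon_dvd_def by blast
  qed (auto simp: mon_dvd_def in_keys_iff lookup_add)
  have "m \<notin> path_monomials d \<longleftrightarrow> (\<exists>i j. (i, j) \<in> Poly_Mapping.keys m \<and> j \<noteq> Suc i)"
    using assms by (auto simp: path_monomials_def monomials_def subset_iff)
  also have "\<dots> \<longleftrightarrow> (\<exists>i j. 1 \<le> i \<and> Suc i < j \<and> j \<le> d \<and> (i, j) \<in> Poly_Mapping.keys m)"
  proof -
    have "1 \<le> i \<and> i < j \<and> j \<le> d" if "(i, j) \<in> Poly_Mapping.keys m" for i j
      using assms that by (auto simp: monomials_def arcs_def)
    then show ?thesis
      by (metis Suc_lessI less_irrefl)
  qed
  finally show ?thesis
    unfolding dvd .
qed

text \<open>Among the arcs from a vertex to its successor, only \<open>(l, Suc l)\<close> crosses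
  from \<open>l\<close> to \<open>Suc l\<close>.\<close>

lemma cut_path_monomial:
  assumes "m \<in> path_monomials d" "1 \<le> l" "l < d"
  shows "cut d l m = Poly_Mapping.lookup m (l, Suc l)"
proof -
  have "cut d l m = (\<Sum>a\<in>arcs d. if a = (l, Suc l) then Poly_Mapping.lookup m (l, Suc l) else 0)"
    unfolding cut_alt
  proof (intro sum.cong refl)
    fix a
    have "Poly_Mapping.lookup m a = 0" if "snd a \<noteq> Suc (fst a)"
    proof -
      have "a \<notin> Poly_Mapping.keys m"
        using assms(1) that by (auto simp: path_monomials_def monomials_def)
      then show ?thesis
        by (simp add: in_keys_iff)
    qed
    moreover have "fst a \<le> l \<and> l < snd a \<longleftrightarrow> a = (l, Suc l)" if "snd a = Suc (fst a)"
      using that by (cases a) auto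
    ultimately show "(if fst a \<le> l \<and> l < snd a then Poly_Mapping.lookup m a else 0) =
      (if a = (l, Suc l) then Poly_Mapping.lookup m (l, Suc l) else 0)"
      by (cases "snd a = Suc (fst a)") auto
  qed
  also have "\<dots> = Poly_Mapping.lookup m (l, Suc l)"
    using assms(2,3) by (simp add: finite_arcs) (simp add: arcs_def)
  finally show ?thesis .
qed

text \<open>The cuts are the exponents of a path monomial. Since they are constant on fibres, a
  fibre contains at most one path monomial.\<close>

lemma path_monomial_eqI:
  assumes m: "m \<in> path_monomials d" "m' \<in> path_monomials d"
    and cut: "\<And>l. 1 \<le> l \<Longrightarrow> l < d \<Longrightarrow> cut d l m = cut d l m'"
  shows "m = m'"
proof (rule poly_mapping_eqI)
  fix a
  show "Poly_Mapping.lookup m a = Poly_Mapping.lookup m' a"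
  proof (cases "a \<in> {(i, j) \<in> arcs d. j = Suc i}")
    case True
    then obtain l where l: "a = (l, Suc l)" "1 \<le> l" "l < d"
      by (auto simp: arcs_def)
    then show ?thesis
      using cut[OF l(2,3)] cut_path_monomial[OF m(1) l(2,3)] cut_path_monomial[OF m(2) l(2,3)] by simp
  next
    case False
    then have "a \<notin> Poly_Mapping.keys m" "a \<notin> Poly_Mapping.keys m'"
      using m by (auto simp: path_monomials_def monomials_def)
    then show ?thesis
      by (simp add: in_keys_iff)
  qed
qed

text \<open>The right-hand side is the weight of the path monomial in the fibre of \<open>u\<close>.\<close>

lemma sum_cut_eq:
  "(\<Sum>l = 1..<d. c (l, Suc l) * real (cut d l u)) =
    (\<Sum>a\<in>arcs d. (\<Sum>l = fst a..<snd a. c (l, Suc l)) * real (Poly_Mapping.lookup u a))"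
proof -
  have "(\<Sum>l = 1..<d. c (l, Suc l) * real (cut d l u)) =
    (\<Sum>l = 1..<d. \<Sum>a\<in>arcs d.
      if fst a \<le> l \<and> l < snd a then c (l, Suc l) * real (Poly_Mapping.lookup u a) else 0)"
    unfolding cut_alt of_nat_sum sum_distrib_left by (intro sum.cong refl) simp
  also have "\<dots> = (\<Sum>a\<in>arcs d. \<Sum>l = 1..<d.
      if fst a \<le> l \<and> l < snd a then c (l, Suc l) * real (Poly_Mapping.lookup u a) else 0)"
    by (rule sum.swap)
  also have "\<dots> = (\<Sum>a\<in>arcs d. (\<Sum>l = fst a..<snd a. c (l, Suc l)) * real (Poly_Mapping.lookup u a))"
  proof (intro sum.cong refl)
    fix a assume "a \<in> arcs d"
    \<comment> \<open>After exchanging the sums, each arc collects exactly the steps of the path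
      joining its ends.\<close>
    then have "{l \<in> {1..<d}. fst a \<le> l \<and> l < snd a} = {fst a..<snd a}"
      by (auto simp: arcs_def)
    then show "(\<Sum>l = 1..<d.
        if fst a \<le> l \<and> l < snd a then c (l, Suc l) * real (Poly_Mapping.lookup u a) else 0) =
      (\<Sum>l = fst a..<snd a. c (l, Suc l)) * real (Poly_Mapping.lookup u a)"
      by (simp add: sum_distrib_right sum.inter_filter[symmetric] del: One_nat_def)
  qed
  finally show ?thesis .
qed

section \<open>Path binomials\<close>

definition path_binomial :: "nat \<Rightarrow> nat \<Rightarrow> (nat \<times> nat, 'k::comm_ring_1) mpoly" where
  "path_binomial i j = monom (Poly_Mapping.single (i, j) 1) - monom (path_mon i j)"

lemma path_binomial_eq: "var (i, j) - (\<Prod>l = i..<j. var (l, Suc l)) = path_binomial i j"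
  by (simp add: path_binomial_def var_def path_mon_def prod_monom)

lemma path_binomial_in_ideal:
  assumes "(i, j) \<in> arcs d"
  shows "path_binomial i j \<in> tournament_ideal d"
proof -
  have "1 \<le> i" "j \<le> d"
    using assms by (auto simp: arcs_def)
  then have "path_mon i j \<in> monomials (arcs d)"
    by (rule path_mon_in_monomials)
  then show ?thesis
    unfolding tournament_ideal_def path_binomial_def
    by (intro toric_ideal_binomialI single_in_monomials mat_apply_path_mon[symmetric] assms)
qed

lemma path_mon_in_path_monomials: "1 \<le> i \<Longrightarrow> j \<le> d \<Longrightarrow> path_mon i j \<in> path_monomials d"
  by (auto simp: path_monomials_def monomials_def keys_path_mon arcs_def)

lemma single_not_in_path_monomials:
  "Suc i < j \<Longrightarrow> Poly_Mapping.single (i, j) 1 \<notin> path_monomials d"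
  by (auto simp: path_monomials_def monomials_def)

lemma lookup_path_binomial:
  "Poly_Mapping.lookup (path_binomial i j) m =
    (if m = Poly_Mapping.single (i, j) 1 then 1 else 0) - (if m = path_mon i j then 1 else 0)"
  by (auto simp: path_binomial_def monom_def lookup_minus lookup_single when_def)

text \<open>Keeps the binomial from collapsing to 0, as it does for
  \<open>j = Suc i\<close>.\<close>

lemma path_mon_ne_single:
  assumes "1 \<le> i" "Suc i < j"
  shows "path_mon i j \<noteq> Poly_Mapping.single (i, j) 1"
  using path_mon_in_path_monomials[of i j j] single_not_in_path_monomials[of i j j] assms by auto

lemma keys_path_binomial:
  assumes "1 \<le> i" "Suc i < j"
  shows "Poly_Mapping.keys (path_binomial i j :: (nat \<times> nat, 'k::comm_ring_1) mpoly) =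
    {Poly_Mapping.single (i, j) 1, path_mon i j}"
  using path_mon_ne_single[OF assms]
  by (auto simp: in_keys_iff lookup_path_binomial split: if_splits simp del: One_nat_def)

definition long_arcs :: "nat \<Rightarrow> (nat \<times> nat) set" where
  "long_arcs d = {(i, j). 1 \<le> i \<and> Suc i < j \<and> j \<le> d}"

lemma mon_dvd_single_single:
  assumes "mon_dvd (Poly_Mapping.single x 1) (Poly_Mapping.single y 1)"
  shows "x = y"
proof -
  obtain r :: "'a monomial" where "Poly_Mapping.single y 1 = Poly_Mapping.single x 1 + r"
    using assms by (auto simp: mon_dvd_def)
  then have "Poly_Mapping.lookup (Poly_Mapping.single y 1) x = 1 + Poly_Mapping.lookup r x"
    by (simp add: lookup_add)
  then show ?thesis
    by (simp add: lookup_single when_def split: if_splits)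
qed

section \<open>Weights within a fibre and initial monomials\<close>

locale tournament_weight =
  fixes d :: nat
    and succ :: "(nat \<times> nat) monomial \<Rightarrow> (nat \<times> nat) monomial \<Rightarrow> bool"
    and c :: "nat \<times> nat \<Rightarrow> real"
  assumes succ: "term_order (arcs d) succ"
    and c: "\<And>i j. 1 \<le> i \<Longrightarrow> Suc i < j \<Longrightarrow> j \<le> d \<Longrightarrow> c (i, j) > (\<Sum>l = i..<j. c (l, Suc l))"
begin

abbreviation "initial \<equiv> initial_mon (refine_order (arcs d) c succ)"

lemma arc_weight_ge: "(i, j) \<in> arcs d \<Longrightarrow> (\<Sum>l = i..<j. c (l, Suc l)) \<le> c (i, j)"
  using c[of i j] by (cases "j = Suc i") (auto simp: arcs_def)

text \<open>For an arc \<open>(l, Suc l)\<close> the path is the arc itself, so the two sums agree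
  term by term.\<close>

lemma weight_path_monomial:
  assumes "m \<in> path_monomials d"
  shows "weight (arcs d) c m = (\<Sum>l = 1..<d. c (l, Suc l) * real (cut d l m))"
  unfolding weight_def sum_cut_eq
  by (intro sum.cong)
    (use assms in \<open>auto simp: path_monomials_def monomials_def in_keys_iff arcs_def\<close>)

text \<open>Replacing arcs by paths never increases the weight, and some arc with
  \<open>j \<noteq> Suc i\<close> has a positive exponent, which makes the comparison
  strict.\<close>

lemma weight_not_path_monomial:
  assumes m: "m \<in> monomials (arcs d)" "m \<notin> path_monomials d"
  shows "weight (arcs d) c m > (\<Sum>l = 1..<d. c (l, Suc l) * real (cut d l m))"
  unfolding weight_def sum_cut_eq
proof (rule sum_strict_mono_ex1)
  obtain i j where ij: "(i, j) \<in> Poly_Mapping.keys m" "(i, j) \<in> arcs d" "j \<noteq> Suc i"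
    using m by (fastforce simp: path_monomials_def monomials_def)
  then have "(\<Sum>l = i..<j. c (l, Suc l)) < c (i, j)"
    using c[of i j] by (auto simp: arcs_def)
  then show "\<exists>a\<in>arcs d. (\<Sum>l = fst a..<snd a. c (l, Suc l)) * real (Poly_Mapping.lookup m a)
      < c a * real (Poly_Mapping.lookup m a)"
    using ij by (intro bexI[of _ "(i, j)"]) (auto simp: in_keys_iff)
qed (auto simp: finite_arcs arc_weight_ge mult_right_mono)

text \<open>The cuts of \<open>m\<close> and \<open>m'\<close> agree, so both weights are compared
  with the same cut sum: one equals it, the other exceeds it.\<close>

lemma weight_less:
  assumes "m \<in> path_monomials d" "m' \<in> monomials (arcs d)" "m' \<notin> path_monomials d"
    and "\<And>r. r \<in> {1..d} \<Longrightarrow> mat_apply (arcs d) incidence m' r = mat_apply (arcs d) incidence m r"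
  shows "weight (arcs d) c m < weight (arcs d) c m'"
proof -
  have "cut d l m = cut d l m'" if "l < d" for l
    using that assms(4) by (intro cut_cong) auto
  then show ?thesis
    using weight_path_monomial[OF assms(1)] weight_not_path_monomial[OF assms(2,3)] by simp
qed

lemma initial_not_path_monomial:
  fixes f :: "(nat \<times> nat, 'k::comm_ring_1) mpoly"
  assumes f: "f \<in> tournament_ideal d" "f \<noteq> 0"
  shows "initial f \<notin> path_monomials d"
proof
  let ?m = "initial f"
  assume path: "?m \<in> path_monomials d"
  have polys: "f \<in> polys (arcs d)"
    using f(1) toric_ideal_subset_polys unfolding tournament_ideal_def by blast
  note ini = initial_mon_props[OF succ polys f(2), where c = c]
  obtain m' where m': "m' \<in> Poly_Mapping.keys f" "m' \<noteq> ?m"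
      "\<And>r. r \<in> {1..d} \<Longrightarrow> mat_apply (arcs d) incidence m' r = mat_apply (arcs d) incidence ?m r"
    using toric_ideal_other_monomial_in_fibre[OF f(1)[unfolded tournament_ideal_def] ini(1)]
    by blast
  have m'V: "m' \<in> monomials (arcs d)"
    using polys m'(1) by (auto simp: polys_def)
  \<comment> \<open>The fibre already contains the path monomial \<open>?m\<close> and has room for
    only one.\<close>
  have "m' \<notin> path_monomials d"
  proof
    assume "m' \<in> path_monomials d"
    then have "m' = ?m"
      using path m'(3) by (intro path_monomial_eqI[of _ d] cut_cong) auto
    with m'(2) show False ..
  qed
  then have "weight (arcs d) c ?m < weight (arcs d) c m'"
    using path m'V m'(3) by (intro weight_less) auto
  then show False
    using ini(2)[OF m'(1,2)] by (auto simp: refine_order_def)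
qed

lemma initial_dvd:
  fixes f :: "(nat \<times> nat, 'k::comm_ring_1) mpoly"
  assumes f: "f \<in> tournament_ideal d" "f \<noteq> 0"
  obtains i j where "1 \<le> i" "Suc i < j" "j \<le> d" "mon_dvd (Poly_Mapping.single (i, j) 1) (initial f)"
    "initial f \<in> Poly_Mapping.keys f" "initial f \<in> monomials (arcs d)"
proof -
  have polys: "f \<in> polys (arcs d)"
    using f(1) toric_ideal_subset_polys unfolding tournament_ideal_def by blast
  have "initial f \<in> Poly_Mapping.keys f"
    using initial_mon_props(1)[OF succ polys f(2)] .
  moreover from this have "initial f \<in> monomials (arcs d)"
    using polys by (auto simp: polys_def)
  ultimately show ?thesis
    using that initial_not_path_monomial[OF f] not_path_monomial_iff_dvd by blast
qed

text \<open>Both terms lie in one fibre and only the second is a path monomial, so the weight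
  decides and \<open>succ\<close> is never consulted.\<close>

lemma initial_path_binomial:
  assumes "1 \<le> i" "Suc i < j" "j \<le> d"
  shows "initial (path_binomial i j :: (nat \<times> nat, 'k::comm_ring_1) mpoly) = Poly_Mapping.single (i, j) 1"
proof (rule initial_mon_eqI[OF succ])
  have arc: "(i, j) \<in> arcs d"
    using assms by (auto simp: arcs_def)
  then show "(path_binomial i j :: (nat \<times> nat, 'k) mpoly) \<in> polys (arcs d)"
    using path_binomial_in_ideal toric_ideal_subset_polys unfolding tournament_ideal_def by blast
  have "weight (arcs d) c (path_mon i j) < weight (arcs d) c (Poly_Mapping.single (i, j) 1)"
    using assms arc
    by (intro weight_less path_mon_in_path_monomials single_in_monomials single_not_in_path_monomials)
      (simp_all add: mat_apply_path_mon del: One_nat_def)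
  then show "refine_order (arcs d) c succ (Poly_Mapping.single (i, j) 1) m'"
    if "m' \<in> Poly_Mapping.keys (path_binomial i j :: (nat \<times> nat, 'k) mpoly)"
      "m' \<noteq> Poly_Mapping.single (i, j) 1" for m'
    using that keys_path_binomial[OF assms(1,2)] by (auto simp: refine_order_def)
qed (use assms in \<open>simp add: keys_path_binomial\<close>)

section \<open>The initial ideal and the reduced Groebner basis\<close>

lemma initial_ideal_tournament_ideal:
  "(initial_ideal (arcs d) (refine_order (arcs d) c succ) (tournament_ideal d) ::
      (nat \<times> nat, 'k::comm_ring_1) mpoly set) =
    ideal_gen (arcs d) (monom ` (\<lambda>x. Poly_Mapping.single x 1) ` long_arcs d)"
  (is "_ = ideal_gen _ ?X")
  unfolding initial_ideal_def
proof (intro equalityI ideal_gen_subset subsetI)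
  fix p :: "(nat \<times> nat, 'k) mpoly"
  assume "p \<in> {monom (initial f) | f :: (nat \<times> nat, 'k) mpoly. f \<in> tournament_ideal d \<and> f \<noteq> 0}"
  then obtain f :: "(nat \<times> nat, 'k) mpoly" where f: "f \<in> tournament_ideal d" "f \<noteq> 0" "p = monom (initial f)"
    by blast
  from f(1,2) show "p \<in> ideal_gen (arcs d) ?X"
    unfolding f(3)
    by (rule initial_dvd) (rule monom_in_ideal_gen_if_mon_dvd, auto simp: long_arcs_def)
next
  fix p :: "(nat \<times> nat, 'k) mpoly"
  assume "p \<in> ?X"
  then obtain i j where ij: "1 \<le> i" "Suc i < j" "j \<le> d" "p = monom (Poly_Mapping.single (i, j) 1)"
    by (auto simp: long_arcs_def)
  let ?f = "path_binomial i j :: (nat \<times> nat, 'k) mpoly"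
  have "(i, j) \<in> arcs d"
    using ij by (simp add: arcs_def)
  then have "?f \<in> tournament_ideal d"
    by (rule path_binomial_in_ideal)
  moreover have "p = monom (initial ?f)"
    using ij by (simp add: initial_path_binomial)
  moreover have "Poly_Mapping.keys ?f \<noteq> {}"
    using ij by (simp add: keys_path_binomial)
  then have "?f \<noteq> 0"
    by auto
  ultimately show "p \<in> ideal_gen (arcs d) {monom (initial f) | f :: (nat \<times> nat, 'k) mpoly. f \<in> tournament_ideal d \<and> f \<noteq> 0}"
    by (intro ideal_gen_base) blast
qed

lemma reduced_groebner_basis_path_binomials:
  "reduced_groebner_basis (arcs d) (refine_order (arcs d) c succ) (tournament_ideal d)
    ((\<lambda>(i, j). path_binomial i j :: (nat \<times> nat, 'k::comm_ring_1) mpoly) ` long_arcs d)"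
  (is "reduced_groebner_basis _ _ _ ?H")
proof -
  have H: "\<exists>i j. g = path_binomial i j \<and> 1 \<le> i \<and> Suc i < j \<and> j \<le> d \<and> initial g = Poly_Mapping.single (i, j) 1"
    if g: "g \<in> ?H" for g
  proof -
    obtain i j where "g = path_binomial i j" "1 \<le> i" "Suc i < j" "j \<le> d"
      using g by (auto simp: long_arcs_def)
    then show ?thesis
      using initial_path_binomial by blast
  qed
  have "finite (long_arcs d)"
    by (rule finite_subset[OF _ finite_arcs]) (auto simp: long_arcs_def arcs_def)
  then have "finite ?H"
    by (rule finite_imageI)
  moreover have "?H \<subseteq> tournament_ideal d"
  proof
    fix g assume "g \<in> ?H"
    then obtain i j where "g = path_binomial i j" "(i, j) \<in> arcs d"
      by (auto simp: long_arcs_def arcs_def)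
    then show "g \<in> tournament_ideal d"
      by (simp add: path_binomial_in_ideal)
  qed
  moreover have "0 \<notin> ?H"
  proof
    assume "0 \<in> ?H"
    then obtain i j where "0 = (path_binomial i j :: (nat \<times> nat, 'k) mpoly)" "1 \<le> i" "Suc i < j"
      by (auto simp: long_arcs_def)
    then show False
      using keys_path_binomial[of i j, where 'k = 'k] by (metis insert_not_empty keys_zero)
  qed
  moreover have "{monom (initial g) | g. g \<in> ?H} =
    (monom ` (\<lambda>x. Poly_Mapping.single x 1) ` long_arcs d :: (nat \<times> nat, 'k) mpoly set)"
  proof -
    have "initial (case x of (i, j) \<Rightarrow> (path_binomial i j :: (nat \<times> nat, 'k) mpoly)) = Poly_Mapping.single x 1"
      if "x \<in> long_arcs d" for x
      using that by (cases x) (simp add: long_arcs_def initial_path_binomial)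
    moreover have "{monom (initial g) | g. g \<in> ?H} = (\<lambda>g. monom (initial g)) ` ?H"
      by blast
    ultimately show ?thesis
      by (simp add: image_image cong: image_cong)
  qed
  moreover have "Poly_Mapping.lookup g (initial g) = 1" if g: "g \<in> ?H" for g
  proof -
    obtain i j where "g = path_binomial i j" "1 \<le> i" "Suc i < j" "initial g = Poly_Mapping.single (i, j) 1"
      using H[OF g] by blast
    then show ?thesis
      using path_mon_ne_single[of i j] by (simp add: lookup_path_binomial del: One_nat_def)
  qed
  moreover have "h = g \<and> m = initial g"
    if gH: "g \<in> ?H" and hH: "h \<in> ?H" and mg: "m \<in> Poly_Mapping.keys g" and dvd: "mon_dvd (initial h) m" for g h m
  proof -
    obtain i j where g: "g = path_binomial i j" "1 \<le> i" "Suc i < j" "j \<le> d"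
        "initial g = Poly_Mapping.single (i, j) 1"
      using H[OF gH] by blast
    obtain a b where h: "h = path_binomial a b" "1 \<le> a" "Suc a < b" "b \<le> d"
        "initial h = Poly_Mapping.single (a, b) 1"
      using H[OF hH] by blast
    have "mon_dvd (Poly_Mapping.single (a, b) 1) m"
      using dvd unfolding h(5) .
    \<comment> \<open>The trailing term is a path monomial, hence divisible by no initial variable.
      This leaves only the initial monomial of \<open>g\<close>.\<close>
    have "m \<noteq> path_mon i j"
    proof
      assume m: "m = path_mon i j"
      then have "m \<in> path_monomials d"
        using g by (simp add: path_mon_in_path_monomials)
      then show False
        using not_path_monomial_iff_dvd[of m d] path_monomials_subset[of d] h(2-4)
          \<open>mon_dvd (Poly_Mapping.single (a, b) 1) m\<close> by blast
    qed
    then have m: "m = Poly_Mapping.single (i, j) 1"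
      using mg unfolding g(1) keys_path_binomial[OF g(2,3)] by blast
    have "(a, b) = (i, j)"
      using \<open>mon_dvd (Poly_Mapping.single (a, b) 1) m\<close> unfolding m by (rule mon_dvd_single_single)
    then show ?thesis
      using g(1,5) h(1) m by simp
  qed
  ultimately show ?thesis
    unfolding reduced_groebner_basis_def groebner_basis_def initial_ideal_tournament_ideal
    by (intro conjI ballI impI) (assumption | simp)+
qed

text \<open>The difference lies in the ideal and has only path monomials in its support. If it were
  nonzero, its initial monomial would be one of them, which is impossible.\<close>

lemma tournament_ideal_eqI:
  fixes f g :: "(nat \<times> nat, 'k::comm_ring_1) mpoly"
  assumes "f \<in> tournament_ideal d" "g \<in> tournament_ideal d"
    and "\<And>m. m \<in> monomials (arcs d) \<Longrightarrow> m \<notin> path_monomials d \<Longrightarrow>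
      Poly_Mapping.lookup f m = Poly_Mapping.lookup g m"
  shows "f = g"
proof (rule ccontr)
  assume "f \<noteq> g"
  have "f - g \<in> tournament_ideal d"
    using assms(1,2) unfolding tournament_ideal_def toric_ideal_def by (rule ideal_gen_diff)
  then show False
    by (rule initial_dvd)
      (use \<open>f \<noteq> g\<close> assms(3) not_path_monomial_iff_dvd in \<open>auto simp: in_keys_iff lookup_minus\<close>)
qed

lemma reduced_groebner_basis_unique:
  fixes G :: "(nat \<times> nat, 'k::comm_ring_1) mpoly set"
  assumes "reduced_groebner_basis (arcs d) (refine_order (arcs d) c succ) (tournament_ideal d) G"
  shows "G = (\<lambda>(i, j). path_binomial i j) ` long_arcs d"
proof -
  have G: "g \<in> tournament_ideal d" "g \<noteq> 0" "Poly_Mapping.lookup g (initial g) = 1" if "g \<in> G" for g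
    using that assms unfolding reduced_groebner_basis_def groebner_basis_def by blast+
  have reduced: "h = g \<and> m = initial g"
    if "g \<in> G" "h \<in> G" "m \<in> Poly_Mapping.keys g" "mon_dvd (initial h) m" for g h m
    using that assms unfolding reduced_groebner_basis_def by blast
  have ideal: "ideal_gen (arcs d) (monom ` initial ` G) =
      (ideal_gen (arcs d) (monom ` (\<lambda>x. Poly_Mapping.single x 1) ` long_arcs d) :: (nat \<times> nat, 'k) mpoly set)"
  proof -
    have "{monom (initial g) | g. g \<in> G} = (monom ` initial ` G :: (nat \<times> nat, 'k) mpoly set)"
      by blast
    then show ?thesis
      using assms
      unfolding reduced_groebner_basis_def groebner_basis_def initial_ideal_tournament_ideal
      by simp
  qed
  \<comment> \<open>The variable lies in the initial ideal, so some \<open>initial g\<close> divides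
    it. In turn \<open>initial g\<close> is divisible by such a variable, and a variable divides
    another only if they are equal, so all three coincide.\<close>
  have ex: "\<exists>g\<in>G. initial g = Poly_Mapping.single (i, j) 1" if ij: "(i, j) \<in> long_arcs d" for i j
  proof -
    have "(monom (Poly_Mapping.single (i, j) 1) :: (nat \<times> nat, 'k) mpoly) \<in>
        ideal_gen (arcs d) (monom ` initial ` G)"
      unfolding ideal using ij by (intro ideal_gen_base imageI)
    then obtain g where g: "g \<in> G" "mon_dvd (initial g) (Poly_Mapping.single (i, j) 1)"
      by (rule mon_dvd_if_monom_in_ideal_gen) blast
    obtain a b where ab: "mon_dvd (Poly_Mapping.single (a, b) 1) (initial g)"
      using initial_dvd[OF G(1,2)[OF g(1)]] by blast
    obtain s t where st: "initial g = Poly_Mapping.single (a, b) 1 + s"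
        "Poly_Mapping.single (i, j) 1 = initial g + t"
      using ab g(2) unfolding mon_dvd_def by blast
    have sum: "Poly_Mapping.single (i, j) 1 = Poly_Mapping.single (a, b) 1 + (s + t)"
      unfolding st(2) unfolding st(1) by (rule add.assoc)
    then have ab_eq: "(a, b) = (i, j)"
      by (intro mon_dvd_single_single) (unfold mon_dvd_def, blast)
    have "s + t = 0"
      using sum unfolding ab_eq by (metis add_left_cancel add_0_right)
    \<comment> \<open>Exponents are natural numbers, so a vanishing sum has vanishing
      summands.\<close>
    have "s = 0"
    proof (rule poly_mapping_eqI)
      fix x
      have "Poly_Mapping.lookup s x + Poly_Mapping.lookup t x = 0"
        using \<open>s + t = 0\<close> by (metis lookup_add lookup_zero)
      then show "Poly_Mapping.lookup s x = Poly_Mapping.lookup 0 x"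
        by simp
    qed
    then have "initial g = Poly_Mapping.single (i, j) 1"
      using st(1) ab_eq by simp
    then show ?thesis
      using g(1) by blast
  qed
  \<comment> \<open>By reducedness, the only monomial of \<open>g\<close> that is not a path
    monomial is its initial one, with coefficient 1. The binomial has the same property, so
    \<open>tournament_ideal_eqI\<close> applies.\<close>
  have eq: "g = path_binomial i j"
    if g: "g \<in> G" "initial g = Poly_Mapping.single (i, j) 1" and ij: "(i, j) \<in> long_arcs d" for g i j
  proof (rule tournament_ideal_eqI)
    show "path_binomial i j \<in> tournament_ideal d"
      using ij by (intro path_binomial_in_ideal) (auto simp: long_arcs_def arcs_def)
    fix m assume m: "m \<in> monomials (arcs d)" "m \<notin> path_monomials d"
    then obtain a b where ab: "(a, b) \<in> long_arcs d" "mon_dvd (Poly_Mapping.single (a, b) 1) m"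
      using not_path_monomial_iff_dvd[OF m(1)] unfolding long_arcs_def by blast
    obtain h where h: "h \<in> G" "initial h = Poly_Mapping.single (a, b) 1"
      using ex[OF ab(1)] by blast
    have "Poly_Mapping.lookup g m = 0" if "m \<noteq> Poly_Mapping.single (i, j) 1"
    proof (rule ccontr)
      assume "Poly_Mapping.lookup g m \<noteq> 0"
      then have "m = initial g"
        using reduced[OF g(1) h(1), of m] ab(2) unfolding h(2) in_keys_iff by blast
      then show False
        using that g(2) by simp
    qed
    moreover have "m \<noteq> path_mon i j"
      using m(2) ij path_mon_in_path_monomials[of i j d] by (auto simp: long_arcs_def)
    ultimately show "Poly_Mapping.lookup g m = Poly_Mapping.lookup (path_binomial i j) m"
      using G(3)[OF g(1)] unfolding g(2) lookup_path_binomial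
      by (cases "m = Poly_Mapping.single (i, j) 1") simp_all
  qed (rule G(1)[OF g(1)])
  have "g \<in> (\<lambda>(i, j). path_binomial i j) ` long_arcs d" if g: "g \<in> G" for g
  proof -
    obtain i j where ij: "(i, j) \<in> long_arcs d" "mon_dvd (Poly_Mapping.single (i, j) 1) (initial g)"
        "initial g \<in> Poly_Mapping.keys g"
      using initial_dvd[OF G(1,2)[OF g]] unfolding long_arcs_def by blast
    obtain h where h: "h \<in> G" "initial h = Poly_Mapping.single (i, j) 1"
      using ex[OF ij(1)] by blast
    \<comment> \<open>The initial monomial of \<open>h\<close> divides a monomial of
      \<open>g\<close>, so reducedness identifies the two. In particular \<open>initial g\<close> is
      itself a variable.\<close>
    have "h = g"
      using reduced[OF g h(1) ij(3)] ij(2) h(2) by simp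
    then show ?thesis
      using eq[OF h ij(1)] ij(1) by auto
  qed
  moreover have "path_binomial i j \<in> G" if ij: "(i, j) \<in> long_arcs d" for i j
    using ex[OF ij] eq[OF _ _ ij] by blast
  ultimately show ?thesis
    by auto
qed

end

text \<open>The equivalence expresses existence and uniqueness together: the given set is a reduced
  Groebner basis, and there is no other.\<close>

theorem theorem4p10:
  fixes d :: nat
    and succ :: "(nat \<times> nat) monomial \<Rightarrow> (nat \<times> nat) monomial \<Rightarrow> bool"
    and c :: "nat \<times> nat \<Rightarrow> real"
    and G :: "(nat \<times> nat, 'k::field) mpoly set"
  assumes "term_order (arcs d) succ"
    and "\<And>i j. 1 \<le> i \<Longrightarrow> Suc i < j \<Longrightarrow> j \<le> d \<Longrightarrow> c (i, j) > (\<Sum>l = i..<j. c (l, Suc l))"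
  shows "reduced_groebner_basis (arcs d) (refine_order (arcs d) c succ) (tournament_ideal d) G \<longleftrightarrow>
    G = {var (i, j) - (\<Prod>l = i..<j. var (l, Suc l)) | i j. 1 \<le> i \<and> Suc i < j \<and> j \<le> d}"
proof -
  interpret tournament_weight d succ c
    using assms by unfold_locales
  have "{var (i, j) - (\<Prod>l = i..<j. var (l, Suc l)) | i j. 1 \<le> i \<and> Suc i < j \<and> j \<le> d} =
      ((\<lambda>(i, j). path_binomial i j) ` long_arcs d :: (nat \<times> nat, 'k) mpoly set)"
    by (auto simp: path_binomial_eq long_arcs_def)
  then show ?thesis
    using reduced_groebner_basis_path_binomials reduced_groebner_basis_unique by metis
qed

end
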